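(* Let $D_0>0$ and $R>0$, and let $\mathbf g:\mathbb R\times\mathbb C^d\to\mathbb C^d$ be a periodic vector field with Fourier coefficients $\mathbf g_{\boldsymbol\alpha}(t)=[g_{1,\boldsymbol\alpha}(t),\ldots,g_{d,\boldsymbol\alpha}(t)]^T$, $\boldsymbol\alpha\in\mathbb Z^d$, such that (1) $\mathbf g_{\boldsymbol\alpha}(t)=\mathbf 0$ for all $\boldsymbol\alpha\in\mathbb Z^d\setminus\mathbb Z_+^d$ and $t\ge 0$; and (2) $\sup_{t\ge 0}\sum_{|\boldsymbol\alpha|=k}\sum_{j=1}^d |g_{j,\boldsymbol\alpha}(t)|\le D_0R^{-k}$ for all integers $k\ge 0$. Let $\mathbf x(t)=[x_1(t),\ldots,x_d(t)]^T$ be the solution of $\dot{\mathbf x}=\mathbf g(t,\mathbf x)$, $t\ge0$, with initial state $\mathbf x(0)=\mathbf x_0=[x_{0,1},\ldots,x_{0,d}]^T\in\mathbb C^d$ satisfying $\|\exp(i\mathbf x_0)\|_\infty<e^{-1}R$. Set $$T_{CF}^*=\frac{e-1}{D_0(2e-1)}\big(\ln R-\ln\|\exp(i\mathbf x_0)\|_\infty-1\big),$$ $$C_0=\frac{1}{\sqrt{2\pi}(e-1)}\exp\Big(\frac{3e-1}{2e-1}\max_{1\le j\le d}\Im x_{0,j}+\frac{3e-1}{2e-1}\ln R-\frac{e}{2e-1}\Big).$$ Let $T^{**}\le T_{CF}^*$ and suppose that the order $N\ge 1$ of the finite-section approximation satisfies $$C_0N^{-3/2}e^{-D_0(T_{CF}^*-T^{**})N}\le\tfrac12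 .$$ Then the entries $v_{1,N},\ldots,v_{d,N}$ of the first block of the finite-section approximation of order $N$ (defined in the context) do not vanish on $[0,T^{**}]$, so that they can be written $v_{j,N}(t)=e^{i\xi_{j,N}(t)}$ with $\xi_{j,N}$ continuous and $\xi_{j,N}(0)=x_{0,j}$, $1\le j\le d$, and $$\sup_{1\le j\le d}|\xi_{j,N}(t)-x_j(t)|\le 4C_0N^{-3/2}e^{D_0tN}\Big(\frac{e\,\|\exp(i\mathbf x_0)\|_\infty}{R}\Big)^{(e-1)N/(2e-1)}\quad\text{for all }0\le t\le T^{**}.$$
   Context: Notation: $\mathbb Z_+^d$ is the set of $d$-tuples of nonnegative integers; for $\boldsymbol\alpha\in\mathbb Z^d$, $|\boldsymbol\alpha|=|\alpha_1|+\cdots+|\alpha_d|$ and $\boldsymbol\alpha\mathbf x=\alpha_1x_1+\cdots+\alpha_dx_d$; $\mathbb Z_{+,k}^d=\{\boldsymbol\alpha\in\mathbb Z_+^d:|\boldsymbol\alpha|=k\}$. $\Im$ denotes imaginary part; $\exp(i\mathbf x)$ is taken componentwise; $\|\cdot\|_p$ is the standard $p$-norm on $\mathbb C^d$, so $\|\exp(i\mathbf x_0)\|_\infty=\exp(-\min_j\Im x_{0,j})$. The periodic vector field $\mathbf g$ is given by its Fourier expansion $\mathbf g(t,\mathbf x)=\sum_{\boldsymbol\alpha\in\mathbb Z^d}\mathbf g_{\boldsymbol\alpha}(t)e^{i\boldsymbol\alpha\mathbf x}$ (which, under (1) and (2), converges when $\min_j\Im x_j>-\ln R$). Finite-section approximation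 of the Carleman-Fourier linearization: put $$\mathbf B_{k,l}(t)=\big[\,i\,\boldsymbol\alpha^T\mathbf g_{\boldsymbol\beta-\boldsymbol\alpha}(t)\,\big]_{\boldsymbol\alpha\in\mathbb Z_{+,k}^d,\ \boldsymbol\beta\in\mathbb Z_{+,l}^d},\qquad k,l\ge1 .$$ The finite-section approximation of order $N\ge1$ is the finite linear ODE system $$\dot{\mathbf v}_{k,N}(t)=\sum_{l=k}^N\mathbf B_{k,l}(t)\mathbf v_{l,N}(t),\qquad \mathbf v_{k,N}(0)=[e^{i\boldsymbol\alpha\mathbf x_0}]_{\boldsymbol\alpha\in\mathbb Z_{+,k}^d},\qquad 1\le k\le N .$$ Its first block $\mathbf v_{1,N}$ is indexed by the unit vectors $\mathbf e_1,\ldots,\mathbf e_d$; its entry with index $\mathbf e_j$ is the scalar denoted $v_{j,N}(t)$. *)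

theory Defs
  imports "HOL-Analysis.Analysis"
begin

type_synonym 'd multi_index = "int ^ 'd"

definition mi_abs :: "'d::finite multi_index \<Rightarrow> int"
  where "mi_abs \<alpha> = (\<Sum>j\<in>UNIV. \<bar>\<alpha> $ j\<bar>)"

definition mi_dot :: "'d::finite multi_index \<Rightarrow> complex ^ 'd \<Rightarrow> complex"
  where "mi_dot \<alpha> x = (\<Sum>j\<in>UNIV. of_int (\<alpha> $ j) * x $ j)"

definition mi_nonneg :: "'d::finite multi_index set"
  where "mi_nonneg = {\<alpha>. \<forall>j. 0 \<le> \<alpha> $ j}"

definition mi_nonneg_deg :: "nat \<Rightarrow> 'd::finite multi_index set"
  where "mi_nonneg_deg k = {\<alpha> \<in> mi_nonneg. mi_abs \<alpha> = int k}"

text \<open>The finite sums over multi-indices of a given order used below are genuine sums:\<close>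

lemma finite_mi_abs_eq: "finite {\<alpha> :: 'd::finite multi_index. mi_abs \<alpha> = int k}"
proof (rule finite_subset)
  show "{\<alpha> :: 'd multi_index. mi_abs \<alpha> = int k} \<subseteq> vec_lambda ` (UNIV \<rightarrow>\<^sub>E {- int k..int k})"
  proof
    fix \<alpha> :: "'d multi_index"
    assume "\<alpha> \<in> {\<alpha>. mi_abs \<alpha> = int k}"
    then have *: "(\<Sum>j\<in>UNIV. \<bar>\<alpha> $ j\<bar>) = int k"
      by (simp add: mi_abs_def)
    have "\<bar>\<alpha> $ i\<bar> \<le> int k" for i
      unfolding *[symmetric] by (rule member_le_sum) auto
    then have "vec_nth \<alpha> \<in> UNIV \<rightarrow>\<^sub>E {- int k..int k}"
      by (auto simp: PiE_def abs_le_iff minus_le_iff)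
    then show "\<alpha> \<in> vec_lambda ` (UNIV \<rightarrow>\<^sub>E {- int k..int k})"
      by (metis imageI vec_nth_inverse)
  qed
  show "finite (vec_lambda ` (UNIV \<rightarrow>\<^sub>E {- int k..int k}) :: 'd multi_index set)"
    by (intro finite_imageI finite_PiE) auto
qed

lemma finite_mi_nonneg_deg: "finite (mi_nonneg_deg k :: 'd::finite multi_index set)"
  by (rule finite_subset[OF _ finite_mi_abs_eq[of k]]) (auto simp: mi_nonneg_deg_def)

definition exp_i :: "complex ^ 'd \<Rightarrow> complex ^ 'd::finite"
  where "exp_i x = (\<chi> j. exp (\<i> * x $ j))"

text \<open>The complex maximum norm; \<^const>\<open>infnorm\<close> on \<^typ>\<open>complex ^ 'd\<close> would instead
  maximise over the real and imaginary parts of the components.\<close>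

definition cmax_norm :: "complex ^ 'd::finite \<Rightarrow> real"
  where "cmax_norm z = (MAX j\<in>UNIV. cmod (z $ j))"

definition periodic_field :: "(real \<Rightarrow> complex ^ 'd \<Rightarrow> complex ^ 'd::finite) \<Rightarrow> bool"
  where "periodic_field g \<longleftrightarrow> (\<forall>t x j. g t (x + axis j (2 * of_real pi)) = g t x)"

text \<open>The expansion is required exactly on the half space where coefficients supported on
  nonnegative multi-indices and of size \<open>O(R\<^sup>-\<^sup>k)\<close> at order \<open>k\<close> make it converge
  absolutely; it says nothing about \<open>g\<close> elsewhere.\<close>

definition fourier_expansion ::
    "(real \<Rightarrow> complex ^ 'd \<Rightarrow> complex ^ 'd) \<Rightarrow> ('d multi_index \<Rightarrow> real \<Rightarrow> complex ^ 'd::finite)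
      \<Rightarrow> real \<Rightarrow> bool"
  where "fourier_expansion g gc R \<longleftrightarrow>
    (\<forall>t\<ge>0. \<forall>x. (\<forall>j. Im (x $ j) > - ln R) \<longrightarrow>
      ((\<lambda>\<alpha>. exp (\<i> * mi_dot \<alpha> x) *s gc \<alpha> t) has_sum g t x) UNIV)"

text \<open>The \<open>(\<alpha>, \<beta>)\<close> entry of the block \<open>B\<^sub>k\<^sub>,\<^sub>l(t)\<close>, where \<open>k\<close> and \<open>l\<close> are the orders
  of \<open>\<alpha>\<close> and \<open>\<beta>\<close>.\<close>

definition cf_entry ::
    "('d::finite multi_index \<Rightarrow> real \<Rightarrow> complex ^ 'd) \<Rightarrow> real
      \<Rightarrow> 'd multi_index \<Rightarrow> 'd multi_index \<Rightarrow> complex"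
  where "cf_entry gc t \<alpha> \<beta> = \<i> * (\<Sum>j\<in>UNIV. of_int (\<alpha> $ j) * gc (\<beta> - \<alpha>) t $ j)"

text \<open>\<open>v k \<alpha> t\<close> is the entry with index \<open>\<alpha>\<close> of the block \<open>v\<^sub>k\<^sub>,\<^sub>N(t)\<close>; it is only
  relevant for \<open>\<alpha> \<in> mi_nonneg_deg k\<close>.\<close>

definition finite_section_solution ::
    "('d::finite multi_index \<Rightarrow> real \<Rightarrow> complex ^ 'd) \<Rightarrow> complex ^ 'd \<Rightarrow> nat \<Rightarrow> real set
      \<Rightarrow> (nat \<Rightarrow> 'd multi_index \<Rightarrow> real \<Rightarrow> complex) \<Rightarrow> bool"
  where "finite_section_solution gc x0 N S v \<longleftrightarrow>
    (\<forall>k\<in>{1..N}. \<forall>\<alpha>\<in>mi_nonneg_deg k.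
      v k \<alpha> 0 = exp (\<i> * mi_dot \<alpha> x0) \<and>
      (\<forall>t\<in>S. (v k \<alpha> has_vector_derivative
          (\<Sum>l=k..N. \<Sum>\<beta>\<in>mi_nonneg_deg l. cf_entry gc t \<alpha> \<beta> * v l \<beta> t)) (at t within S)))"

definition T_CF :: "real \<Rightarrow> real \<Rightarrow> complex ^ 'd::finite \<Rightarrow> real"
  where "T_CF D0 R x0 =
    (exp 1 - 1) / (D0 * (2 * exp 1 - 1)) * (ln R - ln (cmax_norm (exp_i x0)) - 1)"

definition C_CF :: "real \<Rightarrow> complex ^ 'd::finite \<Rightarrow> real"
  where "C_CF R x0 =
    1 / (sqrt (2 * pi) * (exp 1 - 1)) *
    exp ((3 * exp 1 - 1) / (2 * exp 1 - 1) * (MAX j\<in>UNIV. Im (x0 $ j))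
       + (3 * exp 1 - 1) / (2 * exp 1 - 1) * ln R
       - exp 1 / (2 * exp 1 - 1))"

end

theory Submission imports Defs begin

text \<open>
  Along a solution, the monomials \<open>w\<^sub>\<alpha> = exp (i \<alpha> x)\<close> with \<open>\<alpha>\<close> of degree \<open>k\<close> satisfy a linear system in
  which, because the Fourier coefficients live on nonnegative multi-indices, block \<open>k\<close> is driven
  only by the blocks \<open>l \<ge> k\<close>. The finite section drops the blocks beyond \<open>N\<close>, so its error solves
  the truncated system with zero initial value and the dropped terms as forcing.

  As long as all \<open>\<bar>exp (i x\<^sub>j)\<bar> < R / e\<close>, the geometric series of the field bounds its speed by
  \<open>D0 e / (e - 1)\<close>. A solution starting at \<open>r < R / e\<close> can therefore at most reach the level
  \<open>R Q\<close> with \<open>Q = (1 / e) (e r / R)\<^bsup>(e - 1) / (2 e - 1)\<^esup> < 1 / e\<close> before the time \<open>T_CF\<close>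
  (\<open>solution_displacement_bound\<close>), and the
  forcing in block \<open>k\<close>, in units of \<open>R ^ k\<close>, stays below \<open>D0 k F\<close> with \<open>F = Q ^ N / (e - 1)\<close>.

  In the same units, the block from \<open>l\<close> to \<open>k\<close> has norm at most \<open>D0 k\<close>
  for the maximum norms, whatever \<open>l \<ge> k\<close> is. So the error is dominated by a scalar triangular
  system of size \<open>N\<close> that can be solved explicitly by means of the eigenvector for its largest
  eigenvalue \<open>D0 N\<close>. The first component of this eigenvector is \<open>N ^ (N - 1) / N!\<close>, which is
  \<open>e ^ N N\<^sup>-\<^sup>3\<^sup>/\<^sup>2\<close> up to a constant by Stirling's formula. This gives
  an error of the order \<open>N\<^sup>-\<^sup>3\<^sup>/\<^sup>2 (e Q) ^ N exp (D0 N t)\<close> (\<open>finite_section_error\<close>,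
  \<open>top_eigvec_1_bound\<close>).

  Finally, \<open>\<bar>exp (i x\<^sub>j)\<bar>\<close> is bounded below by the same bound on the speed. Dividing by it, one sees
  that the relative error of the first block is at most \<open>2 / 3\<close> under the hypothesis on \<open>N\<close>; so the
  principal logarithm of \<open>v\<^sub>j exp (- i x\<^sub>j)\<close> is defined and at most three times the relative error,
  and subtracting \<open>i\<close> times it from \<open>x\<^sub>j\<close> gives \<open>\<xi>\<^sub>j\<close>.
\<close>

section \<open>Comparison with strict supersolutions\<close>

text \<open>If all bounds hold on \<open>[0, \<tau>]\<close>, then the strict inequality between the derivatives at \<open>\<tau>\<close>
  carries each of them a little beyond \<open>\<tau>\<close>: where \<open>norm (u i \<tau>) < U i \<tau>\<close> continuity would do,
  and where equality holds \<open>u i\<close> moves more slowly than \<open>U i\<close>. Derivatives are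
  compared pointwise, without integration, and only at times at which all the bounds hold: this
  makes the lemma fit for a priori estimates, where the bounds themselves control the derivatives.\<close>

lemma norm_le_supersolution:
  fixes u u' :: "'i \<Rightarrow> real \<Rightarrow> 'a::real_normed_vector" and U U' :: "'i \<Rightarrow> real \<Rightarrow> real"
  assumes fin: "finite I"
    and u: "\<And>i t. i \<in> I \<Longrightarrow> t \<in> {0..T} \<Longrightarrow> (u i has_vector_derivative u' i t) (at t within {0..T})"
    and U: "\<And>i t. i \<in> I \<Longrightarrow> t \<in> {0..T} \<Longrightarrow> (U i has_real_derivative U' i t) (at t within {0..T})"
    and init: "\<And>i. i \<in> I \<Longrightarrow> norm (u i 0) \<le> U i 0"
    and strict: "\<And>i t. i \<in> I \<Longrightarrow> t \<in> {0..T} \<Longrightarrow> (\<And>j. j \<in> I \<Longrightarrow> norm (u j t) \<le> U j t)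
      \<Longrightarrow> norm (u' i t) < U' i t"
    and "i \<in> I" "t \<in> {0..T}"
  shows "norm (u i t) \<le> U i t"
proof -
  have T: "0 \<le> T" using \<open>t \<in> {0..T}\<close> by auto
  define good where "good s \<longleftrightarrow> (\<forall>i\<in>I. norm (u i s) \<le> U i s)" for s
  define S where "S = {s\<in>{0..T}. \<forall>r\<in>{0..s}. good r}"
  define \<tau> where "\<tau> = Sup S"
  have contu: "continuous_on {0..T} (u i)" if "i \<in> I" for i
    using u[OF that] by (rule continuous_on_vector_derivative)
  have contU: "continuous_on {0..T} (U i)" if "i \<in> I" for i
    using U[OF that] DERIV_continuous_on by blast
  have "0 \<in> S" using T init by (auto simp: S_def good_def)
  have bdd: "bdd_above S" by (auto simp: S_def intro!: bdd_aboveI[of _ T])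
  have \<tau>: "\<tau> \<in> {0..T}"
    unfolding \<tau>_def using \<open>0 \<in> S\<close> bdd by (auto intro!: cSup_upper cSup_least simp: S_def)
  have below: "good r" if "0 \<le> r" "r < \<tau>" for r
  proof -
    from \<open>r < \<tau>\<close> obtain s where "s \<in> S" "r < s"
      unfolding \<tau>_def using \<open>0 \<in> S\<close> less_cSup_iff[OF _ bdd] by blast
    then show ?thesis using \<open>0 \<le> r\<close> by (auto simp: S_def)
  qed
  have good\<tau>: "good \<tau>"
  proof (cases "\<tau> = 0")
    case True then show ?thesis using init by (simp add: good_def)
  next
    case False
    then have pos: "0 < \<tau>" using \<tau> by auto
    have "norm (u i \<tau>) \<le> U i \<tau>" if "i \<in> I" for i
    proof -
      have sub: "{0..\<tau>} \<subseteq> {0..T}" using \<tau> by auto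
      have "continuous_on {0..\<tau>} (\<lambda>s. U i s - norm (u i s))"
        by (intro continuous_intros continuous_on_subset[OF contu[OF that] sub]
            continuous_on_subset[OF contU[OF that] sub])
      moreover have "closure {0..<\<tau>} = {0..\<tau>}" using pos by simp
      ultimately have "U i \<tau> - norm (u i \<tau>) \<ge> 0"
        using continuous_ge_on_closure[of "{0..<\<tau>}" "\<lambda>s. U i s - norm (u i s)" \<tau> 0] below that pos
        by (auto simp: good_def)
      then show ?thesis by simp
    qed
    then show ?thesis by (simp add: good_def)
  qed
  have "\<tau> = T"
  proof (rule ccontr)
    assume "\<tau> \<noteq> T"
    then have "\<tau> < T" using \<tau> by auto
    have "eventually (\<lambda>s. norm (u i s) \<le> U i s) (at \<tau> within {\<tau><..T})" if "i \<in> I" for i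
    proof -
      \<comment> \<open>Half the gap between the two rates is spent on the error of each linearization at \<open>\<tau>\<close>.\<close>
      define \<delta> where "\<delta> = (U' i \<tau> - norm (u' i \<tau>)) / 2"
      have "norm (u' i \<tau>) < U' i \<tau>" using strict[OF that \<tau>] good\<tau> by (simp add: good_def)
      then have "\<delta> > 0" by (simp add: \<delta>_def)
      have sub: "at \<tau> within {\<tau><..T} \<le> at \<tau> within {0..T}" using \<tau> by (intro at_le) auto
      have du: "eventually (\<lambda>s. norm (u i s - u i \<tau> - (s - \<tau>) *\<^sub>R u' i \<tau>) \<le> \<delta> * norm (s - \<tau>))
          (at \<tau> within {\<tau><..T})"
        using u[OF that \<tau>] \<open>\<delta> > 0\<close> sub
        by (auto simp: has_vector_derivative_def has_derivative_within_alt2 le_filter_def)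
      have dU: "eventually (\<lambda>s. norm (U i s - U i \<tau> - (s - \<tau>) * U' i \<tau>) \<le> \<delta> * norm (s - \<tau>))
          (at \<tau> within {\<tau><..T})"
        using U[OF that \<tau>] \<open>\<delta> > 0\<close> sub
        by (auto simp: has_real_derivative_iff_has_vector_derivative has_vector_derivative_def
            has_derivative_within_alt2 le_filter_def)
      have "eventually (\<lambda>s. s \<in> {\<tau><..T}) (at \<tau> within {\<tau><..T})"
        by (simp add: eventually_at_filter)
      with du dU show ?thesis
      proof eventually_elim
        case (elim s)
        then have s: "s > \<tau>" by simp
        have "norm (u i s) \<le> norm (u i \<tau>) + norm ((s - \<tau>) *\<^sub>R u' i \<tau>)
            + norm (u i s - u i \<tau> - (s - \<tau>) *\<^sub>R u' i \<tau>)"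
          by (smt (verit) add_diff_cancel_left' diff_add_cancel norm_triangle_ineq)
        also have "\<dots> \<le> norm (u i \<tau>) + (s - \<tau>) * norm (u' i \<tau>) + \<delta> * (s - \<tau>)"
          using elim s by simp
        also have "\<dots> = norm (u i \<tau>) + (s - \<tau>) * U' i \<tau> - \<delta> * (s - \<tau>)"
          by (simp add: \<delta>_def field_simps)
        also have "\<dots> \<le> U i s"
          using elim s good\<tau> that unfolding good_def by (smt (verit) real_norm_def)
        finally show ?case .
      qed
    qed
    then have "eventually good (at \<tau> within {\<tau><..T})"
      unfolding good_def using fin by (intro eventually_ball_finite) auto
    then obtain d where d: "d > 0" "\<And>s. \<tau> < s \<Longrightarrow> s \<le> T \<Longrightarrow> s < \<tau> + d \<Longrightarrow> good s"
      unfolding eventually_at by (auto simp: dist_real_def)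
    define s where "s = min T (\<tau> + d / 2)"
    have s: "\<tau> < s" "s \<le> T" "s < \<tau> + d"
      using \<open>\<tau> < T\<close> \<open>d > 0\<close> by (auto simp: s_def)
    have "good r" if "r \<in> {0..s}" for r
      using below[of r] good\<tau> d(2)[of r] that s by (cases r \<tau> rule: linorder_cases) auto
    then have "s \<in> S" using s \<tau> by (auto simp: S_def)
    then have "s \<le> \<tau>" unfolding \<tau>_def using bdd by (rule cSup_upper)
    then show False using s by simp
  qed
  then show ?thesis using good\<tau> below \<open>i \<in> I\<close> \<open>t \<in> {0..T}\<close>
    unfolding good_def by (cases "t = \<tau>") auto
qed

section \<open>Elementary estimates\<close>

lemma has_sum_norm_le:
  fixes f :: "'a \<Rightarrow> 'b::real_normed_vector"
  assumes "(f has_sum s) A"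
    and "\<And>F. finite F \<Longrightarrow> F \<subseteq> A \<Longrightarrow> (\<Sum>a\<in>F. norm (f a)) \<le> C"
  shows "norm s \<le> C"
proof (rule tendsto_upperbound)
  show "((\<lambda>F. norm (sum f F)) \<longlongrightarrow> norm s) (finite_subsets_at_top A)"
    using assms(1) unfolding has_sum_def by (rule tendsto_norm)
  show "\<forall>\<^sub>F F in finite_subsets_at_top A. norm (sum f F) \<le> C"
    by (intro eventually_finite_subsets_at_top_weakI order.trans[OF norm_sum assms(2)])
qed simp

lemma sum_geometric_tail_le:
  fixes q :: real
  assumes "0 \<le> q" "q < 1" "finite I" "\<And>m. m \<in> I \<Longrightarrow> M \<le> m"
  shows "(\<Sum>m\<in>I. q ^ m) \<le> q ^ M / (1 - q)"
proof -
  have "(\<Sum>m\<in>I. q ^ m) = q ^ M * (\<Sum>m\<in>(\<lambda>m. m - M) ` I. q ^ m)"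
  proof -
    have inj: "inj_on (\<lambda>m. m - M) I"
      using assms(4) by (auto intro!: inj_onI simp: eq_diff_iff)
    show ?thesis
      unfolding sum.reindex[OF inj] sum_distrib_left
      using assms(4) by (intro sum.cong) (auto simp flip: power_add)
  qed
  also have "\<dots> \<le> q ^ M * (\<Sum>m. q ^ m)"
    using assms by (intro mult_left_mono sum_le_suminf) (auto intro: summable_geometric)
  also have "\<dots> = q ^ M / (1 - q)"
    using assms by (subst suminf_geometric) auto
  finally show ?thesis .
qed

lemma norm_Ln_1_plus_le:
  assumes "cmod z < 1"
  shows "cmod (Ln (1 + z)) \<le> cmod z / (1 - cmod z)"
proof -
  have "cmod (Ln (1 + z)) \<le> cmod z + cmod (Ln (1 + z) - z)"
    by (metis add.commute diff_add_cancel norm_triangle_ineq)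
  also have "\<dots> \<le> cmod z + (cmod z)\<^sup>2 / (1 - cmod z)"
    using Ln_approx_linear[OF assms] by simp
  also have "\<dots> = cmod z / (1 - cmod z)"
    using assms by (simp add: field_simps power2_eq_square)
  finally show ?thesis .
qed

text \<open>The condition \<open>Q < 1 / e\<close> enters the whole argument through \<open>q / (1 - q) < 1 / (e - 1)\<close>,
  valid for \<open>q < 1 / e\<close>; the strictness is what the comparison principle asks for.\<close>

lemma geometric_ratio_less:
  fixes q Q :: real
  assumes "0 \<le> q" "q \<le> Q" "0 < Q" "Q < exp (-1)"
  shows "q ^ Suc n / (1 - q) < Q ^ n / (exp 1 - 1)"
proof -
  have e: "exp (-1) = 1 / exp (1::real)" by (simp add: exp_minus inverse_eq_divide)
  have e1: "exp (1::real) > 1" by simp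
  have q: "q < 1 / exp 1" using assms e by simp
  then have "q * exp 1 < 1" using e1 by (simp add: field_simps)
  moreover have "q < 1" using q e1 by (smt (verit) divide_le_eq_1)
  ultimately have *: "q / (1 - q) < 1 / (exp 1 - 1)"
    using e1 by (simp add: divide_simps algebra_simps)
  have "q ^ Suc n / (1 - q) = q ^ n * (q / (1 - q))" by simp
  also have "\<dots> \<le> Q ^ n * (q / (1 - q))"
    using assms \<open>q < 1\<close> by (intro mult_right_mono power_mono) auto
  also have "\<dots> < Q ^ n * (1 / (exp 1 - 1))"
    using * assms by (intro mult_strict_left_mono) auto
  finally show ?thesis by simp
qed

text \<open>Stirling's lower bound with the constant \<open>2\<close> in place of \<open>sqrt (2 * pi)\<close>. The trapezoidal
  rule overestimates the integral of the convex function \<open>1 / s\<close> over \<open>[n, n + 1]\<close>, which makes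
  the increment of the logarithm of \<open>n! / (sqrt n * (n / e)\<^sup>n)\<close> at least minus the telescoping
  quantity \<open>1 / (4 n) - 1 / (4 (n + 1))\<close>. Summation from \<open>n = 1\<close> gives the constant
  \<open>exp (3 / 4) \<ge> 2\<close>.\<close>

lemma fact_lower_bound:
  assumes "n \<ge> 1"
  shows "2 * sqrt (real n) * (real n / exp 1) ^ n \<le> fact n"
proof -
  have "(real n + 1/2) * ln (real n) - real n + 3/4 + 1 / (4 * real n) \<le> ln (fact n)"
    using assms
  proof (induction n rule: dec_induct)
    case base
    then show ?case by simp
  next
    case (step n)
    define x where "x = real n"
    have x: "x > 0" using step by (simp add: x_def)
    have "ln (x + 1) - ln x \<le> (inverse x + inverse (x + 1)) / 2"
      using ln_inverse_approx_le[OF x, of 1] by simp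
    then have "(x + 1/2) * (ln (x + 1) - ln x) \<le> (x + 1/2) * ((inverse x + inverse (x + 1)) / 2)"
      using x by (intro mult_left_mono) auto
    also have "\<dots> = 1 + 1 / (4 * x) - 1 / (4 * (x + 1))"
      using x by (simp add: divide_simps) (simp add: algebra_simps)
    finally have "(x + 1 + 1/2) * ln (x + 1) - (x + 1) + 3/4 + 1 / (4 * (x + 1))
        \<le> ((x + 1/2) * ln x - x + 3/4 + 1 / (4 * x)) + ln (x + 1)"
      by (simp add: algebra_simps)
    also have "\<dots> \<le> ln (fact n) + ln (x + 1)"
      using step.IH by (simp add: x_def)
    also have "\<dots> = ln (fact (Suc n))"
      using x by (simp add: x_def ln_mult add_ac)
    finally show ?case by (simp add: x_def add_ac)
  qed
  then have "(real n + 1/2) * ln (real n) - real n + 3/4 \<le> ln (fact n)"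
    using assms by (smt (verit) divide_nonneg_nonneg of_nat_0_le_iff)
  then have "exp ((real n + 1/2) * ln (real n) - real n + 3/4) \<le> fact n"
    by (metis exp_le_cancel_iff exp_ln fact_gt_zero)
  moreover have "exp ((real n + 1/2) * ln (real n) - real n + 3/4)
      = exp (3/4) * (sqrt (real n) * (real n / exp 1) ^ n)"
  proof -
    have "sqrt (real n) = exp (ln (real n) / 2)"
      using assms by (simp add: powr_half_sqrt[symmetric] powr_def)
    moreover have "(real n / exp 1) ^ n = exp (real n * (ln (real n) - 1))"
      using assms by (simp add: exp_of_nat_mult exp_diff)
    ultimately show ?thesis
      by (simp add: exp_add[symmetric] algebra_simps)
  qed
  moreover have "(2::real) \<le> exp (3/4)"
    using exp_lower_Taylor_quadratic[of "3/4"] by (simp add: power2_eq_square)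
  ultimately show ?thesis
    using mult_right_mono[of 2 "exp (3/4)" "sqrt (real n) * (real n / exp 1) ^ n"]
    by (simp add: mult.assoc)
qed

section \<open>The top eigenvector of the majorant matrix\<close>

text \<open>The upper triangular matrix with entries \<open>k\<close> at all positions \<open>(k, l)\<close> with
  \<open>k \<le> l \<le> N\<close>, the Carleman matrix of \<open>z' = z / (1 - z)\<close>, has the eigenvalues \<open>1, \<dots>, N\<close>. The following is its
  eigenvector for \<open>N\<close>, scaled to have last component \<open>1\<close>.\<close>

definition top_eigvec :: "nat \<Rightarrow> nat \<Rightarrow> real"
  where "top_eigvec N k = real k / real N * (real N ^ (N - k) / fact (N - k))"

lemma top_eigvec_nonneg: "0 \<le> top_eigvec N k"
  by (simp add: top_eigvec_def)

lemma top_eigvec_self: "N \<ge> 1 \<Longrightarrow> top_eigvec N N = 1"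
  by (simp add: top_eigvec_def)

text \<open>The tails \<open>S k\<close> of the sum of the components satisfy \<open>N * (S k - S (k + 1)) = k * S k\<close>, that
  is \<open>S k = N / (N - k) * S (k + 1)\<close>, with \<open>S N = 1\<close>; hence the power over the factorial.\<close>

lemma top_eigvec_eigenvector:
  assumes "1 \<le> k" "k \<le> N"
  shows "real k * (\<Sum>l=k..N. top_eigvec N l) = real N * top_eigvec N k"
proof -
  have "(\<Sum>l=k..N. top_eigvec N l) = real N ^ (N - k) / fact (N - k)"
    using \<open>k \<le> N\<close>
  proof (induction k rule: inc_induct)
    case base
    show ?case using assms by (simp add: top_eigvec_self)
  next
    case (step m)
    define i where "i = N - Suc m"
    have i: "N - m = Suc i" "real N = real m + real i + 1" "N - Suc m = i"
      using step by (auto simp: i_def)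
    have "(\<Sum>l=m..N. top_eigvec N l) = top_eigvec N m + (\<Sum>l=Suc m..N. top_eigvec N l)"
      using step by (intro sum.atLeast_Suc_atMost) auto
    also have "\<dots> = real m / real N * (real N ^ Suc i / fact (Suc i)) + real N ^ i / fact i"
      unfolding step.IH top_eigvec_def[of N m] i(1,3) ..
    also have "\<dots> = real N ^ Suc i / fact (Suc i)"
    proof -
      have *: "real m / real N * (real N ^ Suc i / fact (Suc i)) = real m * real N ^ i / fact (Suc i)"
        using assms by simp
      have **: "real N ^ i / fact i = real (Suc i) * real N ^ i / fact (Suc i)"
        by (simp del: of_nat_Suc)
      show ?thesis unfolding * ** add_divide_distrib[symmetric]
        using i(2) by (simp add: algebra_simps)
    qed
    finally show ?case unfolding i(1) .
  qed
  then show ?thesis using assms by (simp add: top_eigvec_def)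
qed

text \<open>The first component is \<open>N ^ (N - 1) / N!\<close>; this is the source of the factor \<open>N\<^sup>-\<^sup>3\<^sup>/\<^sup>2\<close> in the
  error bound.\<close>

lemma top_eigvec_1_bound:
  assumes "N \<ge> 1"
  shows "top_eigvec N 1 \<le> exp 1 ^ N * real N powr (-3/2) / 2"
proof -
  obtain n where n: "N = Suc n" using assms by (cases N) auto
  have s: "real N powr (-3/2) = 1 / (real N * sqrt (real N))"
    using assms powr_add[of "real N" 1 "1/2"] by (simp add: powr_minus_divide powr_half_sqrt)
  have pos: "sqrt (real N) > 0" using assms by simp
  have "top_eigvec N 1 = real N ^ N / (real N * fact N)"
    unfolding n top_eigvec_def fact_Suc by (simp add: divide_simps)
  also have "\<dots> \<le> real N ^ N / (real N * (2 * sqrt (real N) * (real N / exp 1) ^ N))"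
    using assms fact_lower_bound[OF assms] by (intro divide_left_mono mult_left_mono mult_pos_pos) auto
  also have "\<dots> = exp 1 ^ N * real N powr (-3/2) / 2"
    unfolding s using assms by (simp add: power_divide)
  finally show ?thesis .
qed

section \<open>Multi-indices and exponential monomials\<close>

lemma mi_abs_nonneg [simp]: "0 \<le> mi_abs \<alpha>"
  by (simp add: mi_abs_def sum_nonneg)

lemma mi_abs_eq_sum: "\<alpha> \<in> mi_nonneg \<Longrightarrow> mi_abs \<alpha> = (\<Sum>j\<in>UNIV. \<alpha> $ j)"
  by (simp add: mi_abs_def mi_nonneg_def)

lemma mi_abs_add:
  "\<alpha> \<in> mi_nonneg \<Longrightarrow> \<gamma> \<in> mi_nonneg \<Longrightarrow> mi_abs (\<alpha> + \<gamma>) = mi_abs \<alpha> + mi_abs \<gamma>"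
  by (simp add: mi_abs_def mi_nonneg_def sum.distrib)

lemma mi_nonneg_add: "\<alpha> \<in> mi_nonneg \<Longrightarrow> \<gamma> \<in> mi_nonneg \<Longrightarrow> \<alpha> + \<gamma> \<in> mi_nonneg"
  by (simp add: mi_nonneg_def)

lemma norm_mi_component_le:
  assumes "\<alpha> \<in> mi_nonneg_deg k"
  shows "cmod (of_int (\<alpha> $ j)) \<le> real k"
proof -
  have "\<bar>\<alpha> $ j\<bar> \<le> mi_abs \<alpha>"
    unfolding mi_abs_def by (rule member_le_sum) auto
  also have "\<dots> = int k" using assms by (simp add: mi_nonneg_deg_def)
  finally have "real_of_int \<bar>\<alpha> $ j\<bar> \<le> real_of_int (int k)" by (rule of_int_le_iff[THEN iffD2])
  then show ?thesis by (simp add: norm_of_int)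
qed

lemma mi_dot_add: "mi_dot (\<alpha> + \<beta>) x = mi_dot \<alpha> x + mi_dot \<beta> x"
  by (simp add: mi_dot_def algebra_simps sum.distrib)

lemma mi_dot_axis: "mi_dot (axis j 1) x = x $ j"
proof -
  have "mi_dot (axis j 1) x = (\<Sum>i\<in>UNIV. if i = j then x $ i else 0)"
    unfolding mi_dot_def by (intro sum.cong) (auto simp: axis_def)
  then show ?thesis by simp
qed

lemma axis_mem_mi_nonneg_deg: "axis j 1 \<in> mi_nonneg_deg 1"
proof -
  have "(\<Sum>i\<in>UNIV. \<bar>axis j 1 $ i\<bar>) = (\<Sum>i\<in>UNIV. if i = j then 1 else 0::int)"
    by (intro sum.cong) (auto simp: axis_def)
  then show ?thesis
    by (simp add: mi_nonneg_deg_def mi_nonneg_def mi_abs_def axis_def)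
qed

lemma finite_mi_abs_less: "finite {\<alpha> :: 'd::finite multi_index. mi_abs \<alpha> < int M}"
proof -
  have "{\<alpha> :: 'd multi_index. mi_abs \<alpha> < int M} \<subseteq> (\<Union>m<M. {\<alpha>. mi_abs \<alpha> = int m})"
  proof
    fix \<alpha> :: "'d multi_index" assume "\<alpha> \<in> {\<alpha>. mi_abs \<alpha> < int M}"
    then have "nat (mi_abs \<alpha>) < M" "mi_abs \<alpha> = int (nat (mi_abs \<alpha>))"
      by (simp_all add: nat_less_iff)
    then show "\<alpha> \<in> (\<Union>m<M. {\<alpha>. mi_abs \<alpha> = int m})" by blast
  qed
  then show ?thesis by (rule finite_subset) (auto simp: finite_mi_abs_eq)
qed

lemma norm_exp_mi_dot_le:
  assumes "\<alpha> \<in> mi_nonneg" and "\<And>j. cmod (exp (\<i> * x $ j)) \<le> \<rho>"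
  shows "cmod (exp (\<i> * mi_dot \<alpha> x)) \<le> \<rho> ^ nat (mi_abs \<alpha>)"
proof -
  have "exp (\<i> * mi_dot \<alpha> x) = (\<Prod>j\<in>UNIV. exp (\<i> * x $ j) ^ nat (\<alpha> $ j))"
    using assms(1)
    by (simp add: mi_dot_def sum_distrib_left exp_sum mi_nonneg_def flip: exp_of_nat_mult)
      (simp add: algebra_simps)
  then have "cmod (exp (\<i> * mi_dot \<alpha> x)) = (\<Prod>j\<in>UNIV. cmod (exp (\<i> * x $ j)) ^ nat (\<alpha> $ j))"
    by (simp add: prod_norm[symmetric] norm_power)
  also have "\<dots> \<le> (\<Prod>j\<in>UNIV. \<rho> ^ nat (\<alpha> $ j))"
    using assms(2) by (intro prod_mono) (auto intro: power_mono)
  also have "\<dots> = \<rho> ^ nat (mi_abs \<alpha>)"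
  proof -
    have "int (\<Sum>j\<in>UNIV. nat (\<alpha> $ j)) = mi_abs \<alpha>"
      using assms(1) by (simp add: mi_abs_eq_sum) (simp add: mi_nonneg_def)
    then show ?thesis by (metis power_sum nat_int)
  qed
  finally show ?thesis .
qed

lemma cmod_exp_i_le:
  assumes "cmod (y - z) \<le> r"
  shows "cmod (exp (\<i> * y)) \<le> cmod (exp (\<i> * z)) * exp r"
proof -
  have "- Im y \<le> - Im z + r"
    using abs_Im_le_cmod[of "y - z"] assms by simp
  then show ?thesis by (simp add: norm_exp_eq_Re flip: exp_add)
qed

text \<open>With the Fourier series of \<open>g(t, x)\<close> in place of \<open>x'\<close> this becomes the infinite linear system that
  the finite section truncates.\<close>

lemma exponential_has_derivative:
  fixes x :: "real \<Rightarrow> complex ^ 'd::finite"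
  assumes "(x has_vector_derivative x') (at t within S)"
  shows "((\<lambda>t. exp (\<i> * mi_dot \<alpha> (x t))) has_vector_derivative
    exp (\<i> * mi_dot \<alpha> (x t)) * (\<i> * (\<Sum>j\<in>UNIV. of_int (\<alpha> $ j) * x' $ j))) (at t within S)"
proof -
  have "bounded_linear (\<lambda>y :: complex ^ 'd. \<i> * mi_dot \<alpha> y)"
    unfolding mi_dot_def
    by (intro bounded_linear_const_mult bounded_linear_sum bounded_linear_vec_nth)
  from bounded_linear.has_vector_derivative[OF this assms]
  have "((\<lambda>t. \<i> * mi_dot \<alpha> (x t)) has_vector_derivative
      \<i> * (\<Sum>j\<in>UNIV. of_int (\<alpha> $ j) * x' $ j)) (at t within S)"
    by (simp add: mi_dot_def)
  from field_vector_diff_chain_within[OF this DERIV_exp[THEN has_field_derivative_at_within]]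
  show ?thesis by (simp add: o_def mult_ac)
qed

section \<open>Fields with nonnegative Fourier support\<close>

locale analytic_periodic_field =
  fixes D0 R :: real
    and g :: "real \<Rightarrow> complex ^ 'd \<Rightarrow> complex ^ 'd::finite"
    and gc :: "'d multi_index \<Rightarrow> real \<Rightarrow> complex ^ 'd"
  assumes D0_pos: "D0 > 0" and R_pos: "R > 0"
    and expansion: "fourier_expansion g gc R"
    and coeff_zero: "\<And>\<alpha> t. \<alpha> \<notin> mi_nonneg \<Longrightarrow> t \<ge> 0 \<Longrightarrow> gc \<alpha> t = 0"
    and coeff_bound: "\<And>k t. t \<ge> 0 \<Longrightarrow>
      (\<Sum>\<alpha> | mi_abs \<alpha> = int k. \<Sum>j\<in>UNIV. cmod (gc \<alpha> t $ j)) \<le> D0 * R powi (- int k)"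
begin

text \<open>Two linear functionals of the field matter below: a single component (\<open>K = 1\<close>), for the
  growth of the solution, and the one with coefficients \<open>\<alpha>\<close> of degree \<open>K\<close>, for the rows of the
  Carleman-Fourier matrix.\<close>

lemma functional_coeff_bound:
  assumes "t \<ge> 0" and "\<And>j. cmod (a j) \<le> K" and "0 \<le> K"
  shows "(\<Sum>\<gamma> | mi_abs \<gamma> = int m. cmod (\<Sum>j\<in>UNIV. a j * gc \<gamma> t $ j)) \<le> K * D0 / R ^ m"
proof -
  have "cmod (\<Sum>j\<in>UNIV. a j * gc \<gamma> t $ j) \<le> K * (\<Sum>j\<in>UNIV. cmod (gc \<gamma> t $ j))" for \<gamma>
    unfolding sum_distrib_left
    by (rule order.trans[OF norm_sum]) (auto intro!: sum_mono mult_right_mono assms simp: norm_mult)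
  then have "(\<Sum>\<gamma> | mi_abs \<gamma> = int m. cmod (\<Sum>j\<in>UNIV. a j * gc \<gamma> t $ j))
      \<le> K * (\<Sum>\<gamma> | mi_abs \<gamma> = int m. \<Sum>j\<in>UNIV. cmod (gc \<gamma> t $ j))"
    unfolding sum_distrib_left by (intro sum_mono) (simp add: sum_distrib_left)
  also have "\<dots> \<le> K * (D0 * R powi (- int m))"
    by (intro mult_left_mono coeff_bound assms)
  finally show ?thesis by (simp add: power_int_minus divide_inverse)
qed

text \<open>At a point where all \<open>\<bar>exp (i x\<^sub>j)\<bar> \<le> R q\<close>, the terms of degree \<open>m\<close> add up to at most
  \<open>K D0 q ^ m\<close>, since the factor \<open>R ^ m\<close> of the monomials cancels the decay of the coefficients;
  what is left is a geometric series starting at \<open>M\<close>.\<close>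

lemma fourier_tail_bound:
  assumes t: "t \<ge> 0" and q: "0 \<le> q" "q < 1"
    and x: "\<And>j. cmod (exp (\<i> * x $ j)) \<le> R * q"
    and a: "\<And>j. cmod (a j) \<le> K" and K: "0 \<le> K"
  shows "cmod ((\<Sum>j\<in>UNIV. a j * g t x $ j)
      - (\<Sum>\<gamma> | mi_abs \<gamma> < int M. exp (\<i> * mi_dot \<gamma> x) * (\<Sum>j\<in>UNIV. a j * gc \<gamma> t $ j)))
    \<le> K * D0 * (q ^ M / (1 - q))"
proof -
  define f where "f \<gamma> = exp (\<i> * mi_dot \<gamma> x) * (\<Sum>j\<in>UNIV. a j * gc \<gamma> t $ j)" for \<gamma>
  have "Im (x $ j) > - ln R" for j
  proof -
    have "exp (- Im (x $ j)) < exp (ln R)"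
      using x[of j] q R_pos by (simp add: norm_exp_eq_Re)
        (smt (verit) mult_less_cancel_left2)
    then show ?thesis by simp
  qed
  then have "((\<lambda>\<gamma>. exp (\<i> * mi_dot \<gamma> x) *s gc \<gamma> t) has_sum g t x) UNIV"
    using expansion t by (simp add: fourier_expansion_def)
  moreover have "bounded_linear (\<lambda>y :: complex ^ 'd. \<Sum>j\<in>UNIV. a j * y $ j)"
    by (intro bounded_linear_sum bounded_linear_const_mult bounded_linear_vec_nth)
  ultimately have "((\<lambda>\<gamma>. \<Sum>j\<in>UNIV. a j * (exp (\<i> * mi_dot \<gamma> x) *s gc \<gamma> t) $ j)
      has_sum (\<Sum>j\<in>UNIV. a j * g t x $ j)) UNIV"
    by (rule has_sum_bounded_linear[rotated])
  then have "(f has_sum (\<Sum>j\<in>UNIV. a j * g t x $ j)) UNIV"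
    by (simp add: f_def[abs_def] sum_distrib_left mult_ac)
  then have "(f has_sum ((\<Sum>j\<in>UNIV. a j * g t x $ j) - sum f {\<gamma>. mi_abs \<gamma> < int M}))
      (UNIV - {\<gamma>. mi_abs \<gamma> < int M})"
    by (intro has_sum_Diff has_sum_finite finite_mi_abs_less) auto
  then have "cmod ((\<Sum>j\<in>UNIV. a j * g t x $ j) - sum f {\<gamma>. mi_abs \<gamma> < int M})
      \<le> K * D0 * (q ^ M / (1 - q))"
  proof (rule has_sum_norm_le)
    fix F :: "'d multi_index set"
    assume F: "finite F" "F \<subseteq> UNIV - {\<gamma>. mi_abs \<gamma> < int M}"
    define deg where "deg \<gamma> = nat (mi_abs \<gamma>)" for \<gamma> :: "'d multi_index"
    have layer: "(\<Sum>\<gamma>\<in>{\<gamma>\<in>F. deg \<gamma> = m}. cmod (f \<gamma>)) \<le> K * D0 * q ^ m" for m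
    proof -
      have "cmod (f \<gamma>) \<le> (R * q) ^ m * cmod (\<Sum>j\<in>UNIV. a j * gc \<gamma> t $ j)"
        if "mi_abs \<gamma> = int m" for \<gamma>
      proof (cases "\<gamma> \<in> mi_nonneg")
        case True
        then show ?thesis
          using norm_exp_mi_dot_le[OF True x] that
          by (auto simp: f_def norm_mult intro!: mult_right_mono)
      next
        case False
        then show ?thesis using coeff_zero[OF False t] by (simp add: f_def)
      qed
      then have "(\<Sum>\<gamma>\<in>{\<gamma>\<in>F. deg \<gamma> = m}. cmod (f \<gamma>))
          \<le> (\<Sum>\<gamma> | mi_abs \<gamma> = int m. (R * q) ^ m * cmod (\<Sum>j\<in>UNIV. a j * gc \<gamma> t $ j))"
        by (intro order.trans[OF sum_mono sum_mono2] finite_mi_abs_eq)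
          (use q R_pos in \<open>auto simp: deg_def\<close>)
      also have "\<dots> \<le> (R * q) ^ m * (K * D0 / R ^ m)"
        unfolding sum_distrib_left[symmetric] using functional_coeff_bound[OF t a K] q R_pos
        by (intro mult_left_mono) auto
      also have "\<dots> = K * D0 * q ^ m"
        using R_pos by (simp add: power_mult_distrib)
      finally show ?thesis .
    qed
    have "(\<Sum>\<gamma>\<in>F. cmod (f \<gamma>)) = (\<Sum>m\<in>deg ` F. \<Sum>\<gamma>\<in>{\<gamma>\<in>F. deg \<gamma> = m}. cmod (f \<gamma>))"
      using F(1) by (rule sum.image_gen)
    also have "\<dots> \<le> K * D0 * (\<Sum>m\<in>deg ` F. q ^ m)"
      unfolding sum_distrib_left by (intro sum_mono layer)
    also have "\<dots> \<le> K * D0 * (q ^ M / (1 - q))"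
      using F q K D0_pos by (intro mult_left_mono sum_geometric_tail_le) (auto simp: deg_def)
    finally show "(\<Sum>\<gamma>\<in>F. norm (f \<gamma>)) \<le> K * D0 * (q ^ M / (1 - q))" .
  qed
  then show ?thesis by (simp add: f_def)
qed

text \<open>Row sums suit the maximum norm on each block. The weight \<open>R ^ (l - k)\<close> is removed later by
  measuring block \<open>k\<close> in units of \<open>R ^ k\<close>, which leaves the majorant matrix \<open>D0 * k\<close>.\<close>

lemma block_row_bound:
  assumes t: "t \<ge> 0" and \<alpha>: "\<alpha> \<in> mi_nonneg_deg k" and "k \<le> l"
  shows "(\<Sum>\<beta>\<in>mi_nonneg_deg l. cmod (cf_entry gc t \<alpha> \<beta>)) \<le> real k * D0 / R ^ (l - k)"
proof -
  let ?h = "\<lambda>\<gamma>. cmod (\<Sum>j\<in>UNIV. of_int (\<alpha> $ j) * gc \<gamma> t $ j)"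
  have deg: "mi_abs (\<beta> - \<alpha>) = int (l - k)"
    if "\<beta> \<in> mi_nonneg_deg l" "\<beta> - \<alpha> \<in> mi_nonneg" for \<beta>
    using mi_abs_add[of \<alpha> "\<beta> - \<alpha>"] that \<alpha> \<open>k \<le> l\<close> by (auto simp: mi_nonneg_deg_def)
  have "(\<Sum>\<beta>\<in>mi_nonneg_deg l. cmod (cf_entry gc t \<alpha> \<beta>)) = (\<Sum>\<beta>\<in>mi_nonneg_deg l. ?h (\<beta> - \<alpha>))"
    by (simp add: cf_entry_def norm_mult)
  also have "\<dots> = (\<Sum>\<beta>\<in>{\<beta>\<in>mi_nonneg_deg l. \<beta> - \<alpha> \<in> mi_nonneg}. ?h (\<beta> - \<alpha>))"
    using coeff_zero[OF _ t] by (intro sum.mono_neutral_right finite_mi_nonneg_deg) auto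
  also have "\<dots> = (\<Sum>\<gamma>\<in>(\<lambda>\<beta>. \<beta> - \<alpha>) ` {\<beta>\<in>mi_nonneg_deg l. \<beta> - \<alpha> \<in> mi_nonneg}. ?h \<gamma>)"
    by (subst sum.reindex) (auto simp: inj_on_def)
  also have "\<dots> \<le> (\<Sum>\<gamma> | mi_abs \<gamma> = int (l - k). ?h \<gamma>)"
    using deg by (intro sum_mono2 finite_mi_abs_eq) auto
  also have "\<dots> \<le> real k * D0 / R ^ (l - k)"
    using norm_mi_component_le[OF \<alpha>] by (intro functional_coeff_bound t) auto
  finally show ?thesis .
qed

text \<open>Applied to the exact monomials, a row of the finite section is the Fourier series of their
  derivative cut off at degree \<open>N - k\<close>. The reindexing is \<open>\<beta> = \<alpha> + \<gamma>\<close>; all \<open>\<gamma>\<close> outside the nonnegative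
  orthant have coefficient zero.\<close>

lemma truncated_row_sum:
  assumes t: "t \<ge> 0" and \<alpha>: "\<alpha> \<in> mi_nonneg_deg k" and "k \<le> N"
  shows "(\<Sum>l=k..N. \<Sum>\<beta>\<in>mi_nonneg_deg l. cf_entry gc t \<alpha> \<beta> * exp (\<i> * mi_dot \<beta> x))
    = \<i> * exp (\<i> * mi_dot \<alpha> x) * (\<Sum>\<gamma> | mi_abs \<gamma> < int (N - k + 1).
        exp (\<i> * mi_dot \<gamma> x) * (\<Sum>j\<in>UNIV. of_int (\<alpha> $ j) * gc \<gamma> t $ j))"
proof -
  let ?B = "\<Union>l\<in>{k..N}. mi_nonneg_deg l :: 'd multi_index set"
  let ?G = "{\<gamma> :: 'd multi_index. mi_abs \<gamma> < int (N - k + 1)}"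
  let ?h = "\<lambda>\<gamma>. exp (\<i> * mi_dot \<gamma> x) * (\<Sum>j\<in>UNIV. of_int (\<alpha> $ j) * gc \<gamma> t $ j)"
  let ?F = "\<lambda>\<beta>. cf_entry gc t \<alpha> \<beta> * exp (\<i> * mi_dot \<beta> x)"
  have entry_zero: "\<beta> - \<alpha> \<in> mi_nonneg" if "cf_entry gc t \<alpha> \<beta> \<noteq> 0" for \<beta>
    using that by (rule contrapos_np) (simp add: cf_entry_def coeff_zero t)
  have "(\<Sum>l=k..N. sum ?F (mi_nonneg_deg l)) = sum ?F ?B"
    by (intro sum.UNION_disjoint[symmetric])
      (auto simp: finite_mi_nonneg_deg, auto simp: mi_nonneg_deg_def)
  also have "\<dots> = (\<Sum>\<beta>\<in>{\<beta>\<in>?B. \<beta> - \<alpha> \<in> mi_nonneg}. ?F \<beta>)"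
    using entry_zero by (intro sum.mono_neutral_right) (auto simp: finite_mi_nonneg_deg)
  also have "{\<beta>\<in>?B. \<beta> - \<alpha> \<in> mi_nonneg} = (\<lambda>\<gamma>. \<alpha> + \<gamma>) ` (?G \<inter> mi_nonneg)"
  proof (intro set_eqI iffI)
    fix \<beta> assume *: "\<beta> \<in> {\<beta>\<in>?B. \<beta> - \<alpha> \<in> mi_nonneg}"
    then have "mi_abs \<beta> = int k + mi_abs (\<beta> - \<alpha>)" "mi_abs \<beta> \<le> int N"
      using mi_abs_add[of \<alpha> "\<beta> - \<alpha>"] \<alpha> by (auto simp: mi_nonneg_deg_def)
    with * \<open>k \<le> N\<close> show "\<beta> \<in> (\<lambda>\<gamma>. \<alpha> + \<gamma>) ` (?G \<inter> mi_nonneg)"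
      by (intro image_eqI[of _ _ "\<beta> - \<alpha>"]) auto
  next
    fix \<beta> assume "\<beta> \<in> (\<lambda>\<gamma>. \<alpha> + \<gamma>) ` (?G \<inter> mi_nonneg)"
    then obtain \<gamma> where \<gamma>: "\<gamma> \<in> mi_nonneg" "mi_abs \<gamma> < int (N - k + 1)" "\<beta> = \<alpha> + \<gamma>" by auto
    have a: "\<alpha> \<in> mi_nonneg" "mi_abs \<alpha> = int k" using \<alpha> by (auto simp: mi_nonneg_deg_def)
    have "\<beta> \<in> mi_nonneg_deg (k + nat (mi_abs \<gamma>))"
      using \<gamma> a by (simp add: mi_nonneg_deg_def mi_nonneg_add mi_abs_add)
    moreover have "k + nat (mi_abs \<gamma>) \<in> {k..N}" using \<gamma> \<open>k \<le> N\<close> by auto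
    ultimately show "\<beta> \<in> {\<beta>\<in>?B. \<beta> - \<alpha> \<in> mi_nonneg}" using \<gamma> by auto
  qed
  also have "sum ?F \<dots> = (\<Sum>\<gamma>\<in>?G \<inter> mi_nonneg. \<i> * exp (\<i> * mi_dot \<alpha> x) * ?h \<gamma>)"
    by (subst sum.reindex)
      (auto simp: inj_on_def cf_entry_def mi_dot_add distrib_left exp_add mult_ac intro!: sum.cong)
  also have "\<dots> = (\<Sum>\<gamma>\<in>?G. \<i> * exp (\<i> * mi_dot \<alpha> x) * ?h \<gamma>)"
    using coeff_zero[OF _ t] by (intro sum.mono_neutral_left finite_mi_abs_less) auto
  finally show ?thesis by (simp add: sum_distrib_left)
qed


section \<open>The solution stays in the domain of convergence\<close>

text \<open>As long as \<open>\<bar>exp (i x\<^sub>j)\<bar> \<le> R Q\<close> with \<open>Q < 1 / e\<close>, the speed is at most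
  \<open>D0 / (1 - Q) < D0 e / (e - 1)\<close>; and as long as the displacement is below this speed times the
  time, the hypothesis on the initial state keeps \<open>\<bar>exp (i x\<^sub>j)\<bar> \<le> R Q\<close>. The comparison principle breaks
  the circle.\<close>

lemma solution_displacement_bound:
  assumes x: "\<And>t. t \<in> {0..T} \<Longrightarrow> (x has_vector_derivative g t (x t)) (at t within {0..T})"
    and init: "\<And>j. cmod (exp (\<i> * x 0 $ j)) * exp (D0 * exp 1 / (exp 1 - 1) * T) \<le> R * Q"
    and Q: "0 \<le> Q" "Q < exp (-1)"
    and t: "t \<in> {0..T}"
  shows "cmod (x t $ j - x 0 $ j) \<le> D0 * exp 1 / (exp 1 - 1) * t"
proof -
  define c where "c = D0 * exp 1 / (exp 1 - 1)"
  have c: "c > 0" using D0_pos by (simp add: c_def)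
  have e: "exp (-1) = 1 / exp (1::real)" by (simp add: exp_minus inverse_eq_divide)
  have e1: "exp (1::real) > 1" by simp
  have eQ: "Q * exp 1 < 1" using Q e e1 by (simp add: field_simps)
  have Q1: "Q < 1" using Q e e1 by (smt (verit) divide_le_eq_1)
  have "norm (x t $ j - x 0 $ j) \<le> c * t"
  proof (rule norm_le_supersolution[where I = UNIV and T = T and u = "\<lambda>j t. x t $ j - x 0 $ j"
        and u' = "\<lambda>j t. g t (x t) $ j" and U = "\<lambda>_ t. c * t" and U' = "\<lambda>_ _. c" and i = j])
    fix i t assume "t \<in> {0..T}"
    from bounded_linear.has_vector_derivative[OF bounded_linear_vec_nth x[OF this], of i]
    show "((\<lambda>t. x t $ i - x 0 $ i) has_vector_derivative g t (x t) $ i) (at t within {0..T})"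
      by (auto intro!: derivative_eq_intros)
  next
    fix i t assume t: "t \<in> {0..T}" and le: "\<And>j. j \<in> UNIV \<Longrightarrow> norm (x t $ j - x 0 $ j) \<le> c * t"
    have "cmod (exp (\<i> * x t $ j)) \<le> R * Q" for j
    proof -
      have "c * t \<le> c * T" using c t by simp
      then have "cmod (exp (\<i> * x t $ j)) \<le> cmod (exp (\<i> * x 0 $ j)) * exp (c * T)"
        using le[of j] by (intro cmod_exp_i_le) auto
      then show ?thesis using init[of j] by (simp add: c_def)
    qed
    from fourier_tail_bound[of t Q "x t" "\<lambda>j. if j = i then 1 else 0" 1 0, OF _ _ _ this]
    have "cmod (g t (x t) $ i) \<le> D0 / (1 - Q)"
      using t Q Q1 mi_abs_nonneg[where 'a = 'd]
      by (simp add: if_distrib[of "\<lambda>a. a * _"] if_distrib[of cmod] not_less[symmetric]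
          del: mi_abs_nonneg cong: if_cong)
    also have "\<dots> < c"
      using D0_pos eQ Q1 e1 by (simp add: c_def divide_simps algebra_simps)
    finally show "norm (g t (x t) $ i) < c" .
  qed (use t in \<open>auto intro!: derivative_eq_intros\<close>)
  then show ?thesis by (simp add: c_def)
qed

section \<open>Error of the finite section\<close>

text \<open>In units of \<open>R ^ k\<close>, the error of block \<open>k\<close> obeys a linear system dominated by \<open>D0\<close> times the
  majorant matrix, with a truncation term smaller than \<open>D0 * k * F\<close>. With \<open>b\<close> the top eigenvector,
  \<open>U k = F * (b k * exp (D0 N t) - [k = N])\<close> solves the majorant system exactly: the exponential
  part solves the homogeneous equation, and the constant in the last block alone produces the
  forcing \<open>D0 * k * F\<close> in every row. It is nonnegative at time \<open>0\<close>, where the error vanishes.\<close>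

lemma finite_section_error:
  assumes x: "\<And>t. t \<in> {0..T} \<Longrightarrow> (x has_vector_derivative g t (x t)) (at t within {0..T})"
    and small: "\<And>t j. t \<in> {0..T} \<Longrightarrow> cmod (exp (\<i> * x t $ j)) \<le> R * Q"
    and Q: "0 < Q" "Q < exp (-1)"
    and v: "finite_section_solution gc (x 0) N {0..T} v"
    and k: "k \<in> {1..N}" and \<alpha>: "\<alpha> \<in> mi_nonneg_deg k" and t: "t \<in> {0..T}"
  shows "cmod (v k \<alpha> t - exp (\<i> * mi_dot \<alpha> (x t)))
    \<le> R ^ k * (Q ^ N / (exp 1 - 1)) * top_eigvec N k * exp (D0 * real N * t)"
proof -
  define F where "F = Q ^ N / (exp 1 - 1)"
  define E where "E t = exp (D0 * real N * t)" for t
  define I where "I = Sigma {1..N} (mi_nonneg_deg :: nat \<Rightarrow> 'd multi_index set)"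
  define w where "w \<beta> t = exp (\<i> * mi_dot \<beta> (x t))" for \<beta> t
  define U where "U k t = R ^ k * F * (top_eigvec N k * E t - (if k = N then 1 else 0))" for k t
  define v' where "v' k \<alpha> t = (\<Sum>l=k..N. \<Sum>\<beta>\<in>mi_nonneg_deg l. cf_entry gc t \<alpha> \<beta> * v l \<beta> t)"
    for k \<alpha> t
  define w' where "w' \<alpha> t = w \<alpha> t * (\<i> * (\<Sum>j\<in>UNIV. of_int (\<alpha> $ j) * g t (x t) $ j))" for \<alpha> t
  have F: "F > 0" using Q by (simp add: F_def)
  have Q1: "Q < 1" using Q(2) by (smt (verit) one_less_exp_iff)
  have error: "norm (v (fst i) (snd i) t - w (snd i) t) \<le> U (fst i) t"
    if "i \<in> I" for i
  proof (rule norm_le_supersolution[where I = I and T = T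
        and u = "\<lambda>i t. v (fst i) (snd i) t - w (snd i) t" and U = "\<lambda>i t. U (fst i) t"
        and u' = "\<lambda>i t. v' (fst i) (snd i) t - w' (snd i) t"
        and U' = "\<lambda>i t. R ^ fst i * F * (top_eigvec N (fst i) * (D0 * real N * E t))", OF _ _ _ _ _ that t])
    show "finite I" by (auto simp: I_def finite_mi_nonneg_deg)
  next
    fix i t assume "i \<in> I" "t \<in> {0..T}"
    moreover have "(w (snd i) has_vector_derivative w' (snd i) t) (at t within {0..T})"
      unfolding w_def w'_def using exponential_has_derivative[OF x[OF \<open>t \<in> {0..T}\<close>]] .
    ultimately show "((\<lambda>t. v (fst i) (snd i) t - w (snd i) t) has_vector_derivative
        v' (fst i) (snd i) t - w' (snd i) t) (at t within {0..T})"
      using v by (auto simp: I_def finite_section_solution_def v'_def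
          intro!: has_vector_derivative_diff)
  next
    fix i t
    show "(U (fst i) has_real_derivative
        R ^ fst i * F * (top_eigvec N (fst i) * (D0 * real N * E t))) (at t within {0..T})"
      unfolding U_def[abs_def] E_def[abs_def] by (auto intro!: derivative_eq_intros)
  next
    fix i assume "i \<in> I"
    then show "norm (v (fst i) (snd i) 0 - w (snd i) 0) \<le> U (fst i) 0"
      using v F R_pos top_eigvec_nonneg top_eigvec_self[of N]
      by (auto simp: I_def finite_section_solution_def w_def U_def E_def)
  next
    fix i t assume "i \<in> I" and t: "t \<in> {0..T}"
      and le: "\<And>i. i \<in> I \<Longrightarrow>
        norm (v (fst i) (snd i) t - w (snd i) t) \<le> U (fst i) t"
    then obtain k \<alpha> where i: "i = (k, \<alpha>)" and k: "1 \<le> k" "k \<le> N" and \<alpha>: "\<alpha> \<in> mi_nonneg_deg k"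
      by (auto simp: I_def)
    have t0: "t \<ge> 0" using t by simp
    \<comment> \<open>With \<open>row\<close> the truncated system applied to the exact monomials, \<open>v' - row\<close> is linear in the
      errors, and \<open>row - w'\<close> consists of the dropped terms.\<close>
    have le': "cmod (v l \<beta> t - w \<beta> t) \<le> U l t" if "l \<in> {k..N}" "\<beta> \<in> mi_nonneg_deg l" for l \<beta>
      using le[of "(l, \<beta>)"] that k by (simp add: I_def)
    define row where "row = (\<Sum>l=k..N. \<Sum>\<beta>\<in>mi_nonneg_deg l. cf_entry gc t \<alpha> \<beta> * w \<beta> t)"
    have "v' k \<alpha> t - row = (\<Sum>l=k..N. \<Sum>\<beta>\<in>mi_nonneg_deg l. cf_entry gc t \<alpha> \<beta> * (v l \<beta> t - w \<beta> t))"
      by (simp add: v'_def row_def sum_subtractf right_diff_distrib)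
    also have "cmod \<dots> \<le> (\<Sum>l=k..N. \<Sum>\<beta>\<in>mi_nonneg_deg l. cmod (cf_entry gc t \<alpha> \<beta>) * U l t)"
      by (intro sum_norm_le) (auto simp: norm_mult intro!: mult_left_mono le')
    also have "\<dots> \<le> (\<Sum>l=k..N. real k * D0 / R ^ (l - k) * U l t)"
    proof (rule sum_mono)
      fix l assume l: "l \<in> {k..N}"
      have "E t \<ge> 1" using t0 D0_pos by (simp add: E_def)
      then have "U l t \<ge> 0"
        using F R_pos top_eigvec_nonneg[of N l] top_eigvec_self[of N] k l
        by (auto simp: U_def)
      then show "(\<Sum>\<beta>\<in>mi_nonneg_deg l. cmod (cf_entry gc t \<alpha> \<beta>) * U l t)
          \<le> real k * D0 / R ^ (l - k) * U l t"
        unfolding sum_distrib_right[symmetric]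
        using block_row_bound[OF t0 \<alpha>, of l] l by (intro mult_right_mono) auto
    qed
    also have "\<dots> = (\<Sum>l=k..N. real k * D0 * R ^ k * F * (top_eigvec N l * E t - (if l = N then 1 else 0)))"
    proof (rule sum.cong)
      fix l assume "l \<in> {k..N}"
      then have "R ^ l = R ^ (l - k) * R ^ k" by (simp flip: power_add)
      then show "real k * D0 / R ^ (l - k) * U l t
          = real k * D0 * R ^ k * F * (top_eigvec N l * E t - (if l = N then 1 else 0))"
        using R_pos by (simp add: U_def)
    qed simp
    also have "\<dots> = D0 * R ^ k * F * (real k * (\<Sum>l=k..N. top_eigvec N l) * E t - real k)"
      using k by (simp add: sum_distrib_left[symmetric] sum_subtractf sum_distrib_right[symmetric]
          algebra_simps)
    also have "\<dots> = R ^ k * F * (top_eigvec N k * (D0 * real N * E t)) - real k * D0 * R ^ k * F"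
      unfolding top_eigvec_eigenvector[OF k] by (simp add: algebra_simps)
    finally have v_row: "cmod (v' k \<alpha> t - row)
        \<le> R ^ k * F * (top_eigvec N k * (D0 * real N * E t)) - real k * D0 * R ^ k * F" .
    have "w' \<alpha> t - row = \<i> * w \<alpha> t * ((\<Sum>j\<in>UNIV. of_int (\<alpha> $ j) * g t (x t) $ j)
        - (\<Sum>\<gamma> | mi_abs \<gamma> < int (N - k + 1). exp (\<i> * mi_dot \<gamma> (x t))
            * (\<Sum>j\<in>UNIV. of_int (\<alpha> $ j) * gc \<gamma> t $ j)))"
      unfolding row_def w_def w'_def truncated_row_sum[OF t0 \<alpha> k(2)]
      by (simp add: algebra_simps)
    also have "cmod \<dots> \<le> (R * Q) ^ k * (real k * D0 * (Q ^ (N - k + 1) / (1 - Q)))"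
      unfolding norm_mult
    proof (intro mult_mono)
      show "cmod \<i> * cmod (w \<alpha> t) \<le> (R * Q) ^ k"
        using norm_exp_mi_dot_le[of \<alpha> "x t", OF _ small[OF t]] \<alpha>
        by (simp add: w_def mi_nonneg_deg_def)
      show "cmod ((\<Sum>j\<in>UNIV. of_int (\<alpha> $ j) * g t (x t) $ j)
          - (\<Sum>\<gamma> | mi_abs \<gamma> < int (N - k + 1). exp (\<i> * mi_dot \<gamma> (x t))
            * (\<Sum>j\<in>UNIV. of_int (\<alpha> $ j) * gc \<gamma> t $ j)))
          \<le> real k * D0 * (Q ^ (N - k + 1) / (1 - Q))"
        using Q by (intro fourier_tail_bound t0 Q1 small[OF t] norm_mi_component_le[OF \<alpha>]) auto
    qed (use Q R_pos in auto)
    also have "\<dots> = real k * D0 * R ^ k * (Q ^ Suc N / (1 - Q))"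
    proof -
      have "Q ^ Suc N = Q ^ k * Q ^ (N - k + 1)" using k by (simp flip: power_add)
      then show ?thesis
        by (simp only: power_mult_distrib times_divide_eq_right times_divide_eq_left mult_ac)
    qed
    also have "\<dots> < real k * D0 * R ^ k * F"
      unfolding F_def using k D0_pos R_pos Q
      by (intro mult_strict_left_mono geometric_ratio_less) auto
    finally have "cmod (row - w' \<alpha> t) < real k * D0 * R ^ k * F"
      by (simp add: norm_minus_commute)
    with v_row norm_triangle_ineq[of "v' k \<alpha> t - row" "row - w' \<alpha> t"]
    show "norm (v' (fst i) (snd i) t - w' (snd i) t)
        < R ^ fst i * F * (top_eigvec N (fst i) * (D0 * real N * E t))"
      by (simp add: i)
  qed
  have "cmod (v k \<alpha> t - w \<alpha> t) \<le> U k t"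
    using error[of "(k, \<alpha>)"] k \<alpha> by (simp add: I_def)
  also have "\<dots> \<le> R ^ k * F * (top_eigvec N k * E t)"
    unfolding U_def using R_pos F by (intro mult_left_mono) auto
  finally show ?thesis by (simp add: w_def F_def E_def mult.assoc)
qed

end

section \<open>Exponential convergence of the finite sections\<close>

theorem corollary3p2:
  fixes D0 R T :: real
    and g :: "real \<Rightarrow> complex ^ 'd \<Rightarrow> complex ^ 'd::finite"
    and gc :: "'d multi_index \<Rightarrow> real \<Rightarrow> complex ^ 'd"
    and x :: "real \<Rightarrow> complex ^ 'd" and x0 :: "complex ^ 'd"
    and N :: nat
    and v :: "nat \<Rightarrow> 'd multi_index \<Rightarrow> real \<Rightarrow> complex"
  assumes "D0 > 0" and "R > 0"
    and "periodic_field g"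
    and "fourier_expansion g gc R"
    and "\<And>\<alpha> t. \<alpha> \<notin> mi_nonneg \<Longrightarrow> t \<ge> 0 \<Longrightarrow> gc \<alpha> t = 0"
    and "\<And>k t. t \<ge> 0 \<Longrightarrow>
      (\<Sum>\<alpha> | mi_abs \<alpha> = int k. \<Sum>j\<in>UNIV. cmod (gc \<alpha> t $ j)) \<le> D0 * R powi (- int k)"
    and "x 0 = x0"
    and "\<And>t. t \<in> {0..T} \<Longrightarrow> (x has_vector_derivative g t (x t)) (at t within {0..T})"
    and "cmax_norm (exp_i x0) < exp (-1) * R"
    and "T \<le> T_CF D0 R x0"
    and "N \<ge> 1"
    and "C_CF R x0 * real N powr (-3/2) * exp (- D0 * (T_CF D0 R x0 - T) * real N) \<le> 1 / 2"
    and "finite_section_solution gc x0 N {0..T} v"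
  shows "(\<forall>j. \<forall>t\<in>{0..T}. v 1 (axis j 1) t \<noteq> 0) \<and>
    (\<exists>\<xi> :: 'd \<Rightarrow> real \<Rightarrow> complex.
      (\<forall>j. continuous_on {0..T} (\<xi> j) \<and> \<xi> j 0 = x0 $ j \<and>
           (\<forall>t\<in>{0..T}. v 1 (axis j 1) t = exp (\<i> * \<xi> j t))) \<and>
      (\<forall>t\<in>{0..T}. (MAX j\<in>UNIV. cmod (\<xi> j t - x t $ j)) \<le>
         4 * C_CF R x0 * real N powr (-3/2) * exp (D0 * t * real N) *
         (exp 1 * cmax_norm (exp_i x0) / R) powr ((exp 1 - 1) * real N / (2 * exp 1 - 1))))"
proof -
  interpret analytic_periodic_field D0 R g gc
    by standard (fact assms)+
  define e where "e = exp (1::real)"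
  define r where "r = cmax_norm (exp_i x0)"
  define L where "L = ln R - ln r - 1"
  define c where "c = D0 * e / (e - 1)"
  define \<kappa> where "\<kappa> = (e - 1) / (2 * e - 1) * L"
  define Q where "Q = exp (- 1 - \<kappa>)"
  define P where "P = exp (- \<kappa> * real N)"
  have e1: "e > 1" by (simp add: e_def)
  have r_ge: "cmod (exp (\<i> * x0 $ j)) \<le> r" for j
    by (auto simp: r_def cmax_norm_def exp_i_def)
  have r_pos: "r > 0"
    using r_ge[of undefined] by (rule less_le_trans[rotated]) simp
  have r_eq: "r = exp (ln R - 1 - L)"
    using r_pos by (simp add: L_def)
  have L: "L > 0"
  proof -
    have "ln r < ln (exp (-1) * R)"
      using assms(9) r_pos by (intro ln_less_cancel_iff[THEN iffD2]) (auto simp: r_def \<open>R > 0\<close>)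
    then show ?thesis using \<open>R > 0\<close> by (simp add: L_def ln_mult)
  qed
  have D0T_CF: "D0 * T_CF D0 R x0 = \<kappa>"
    using \<open>D0 > 0\<close> by (simp add: T_CF_def \<kappa>_def e_def L_def r_def)
  have "\<kappa> > 0" using L e1 by (simp add: \<kappa>_def)
  then have Q: "0 < Q" "Q < exp (-1)" by (auto simp: Q_def)
  have cT: "c * T \<le> e / (2 * e - 1) * L"
  proof -
    have "c * T \<le> c * T_CF D0 R x0"
      using assms(10) \<open>D0 > 0\<close> e1 by (intro mult_left_mono) (auto simp: c_def)
    also have "\<dots> = e / (e - 1) * (D0 * T_CF D0 R x0)"
      by (simp add: c_def)
    also have "\<dots> = e / (2 * e - 1) * L"
      unfolding D0T_CF \<kappa>_def using e1 by simp
    finally show ?thesis .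
  qed
  \<comment> \<open>\<open>Q\<close> is the largest value that \<open>r * exp (c * t) / R\<close> can reach up to the time bound; multiplied
    by the growth factor \<open>e\<close> per order coming from Stirling's bound it gives \<open>(Q * e) ^ N = P\<close>.\<close>
  have rQ: "r * exp (c * T) \<le> R * Q"
  proof -
    have "r * exp (c * T) \<le> r * exp (e / (2 * e - 1) * L)"
      using cT r_pos by simp
    also have "\<dots> = exp (ln R + (- 1 - L + e / (2 * e - 1) * L))"
      unfolding r_eq by (simp flip: exp_add add: algebra_simps)
    also have "- 1 - L + e / (2 * e - 1) * L = - 1 - \<kappa>"
      using e1 by (simp add: \<kappa>_def field_simps)
    finally show ?thesis using \<open>R > 0\<close> by (simp add: Q_def exp_add)
  qed
  have displacement: "cmod (x t $ j - x0 $ j) \<le> c * T" if t: "t \<in> {0..T}" for t j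
  proof -
    have "cmod (exp (\<i> * x0 $ j)) * exp (c * T) \<le> R * Q" for j
      by (intro order.trans[OF _ rQ] mult_right_mono r_ge) simp
    then have "cmod (x t $ j - x 0 $ j) \<le> c * t"
      unfolding c_def e_def using Q t assms(7)
      by (intro solution_displacement_bound[OF assms(8)]) auto
    also have "\<dots> \<le> c * T"
      using t \<open>D0 > 0\<close> e1 by (intro mult_left_mono) (auto simp: c_def)
    finally show ?thesis by (simp add: assms(7))
  qed
  have small: "cmod (exp (\<i> * x t $ j)) \<le> R * Q" if "t \<in> {0..T}" for t j
    using cmod_exp_i_le[OF displacement[OF that]] mult_right_mono[OF r_ge[of j], of "exp (c * T)"] rQ
    by (smt (verit) exp_gt_zero)
  \<comment> \<open>A quarter of the claimed error bound.\<close>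
  define B where "B t = C_CF R x0 * real N powr (-3/2) * exp (D0 * t * real N) * P" for t
  have C_pos: "C_CF R x0 > 0" using e1 by (simp add: C_CF_def e_def)
  have B_half: "B t \<le> 1 / 2" if "t \<in> {0..T}" for t
  proof -
    have "exp (D0 * t * real N) * P \<le> exp (D0 * T * real N) * P"
      using that \<open>D0 > 0\<close> by (intro mult_right_mono) (auto simp: P_def intro!: mult_right_mono)
    also have "\<dots> = exp (- D0 * (T_CF D0 R x0 - T) * real N)"
      unfolding P_def D0T_CF[symmetric] by (simp flip: exp_add add: algebra_simps)
    finally have "B t \<le> C_CF R x0 * real N powr (-3/2) * exp (- D0 * (T_CF D0 R x0 - T) * real N)"
      unfolding B_def mult.assoc using C_pos by (intro mult_left_mono) auto
    also have "\<dots> \<le> 1 / 2" by (fact assms(12))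
    finally show ?thesis .
  qed
  \<comment> \<open>The relative error of the first block. The factor \<open>4 / 3\<close> pays for the constant \<open>2\<close> instead of
    \<open>sqrt (2 * pi)\<close> in Stirling's bound; it is as large as the final passage to the logarithm admits,
    where \<open>cmod (z j t) \<le> 2 / 3\<close> costs another factor \<open>3\<close>.\<close>
  define z where "z j t = v 1 (axis j 1) t / exp (\<i> * x t $ j) - 1" for j t
  have z_bound: "cmod (z j t) \<le> 4 / 3 * B t" if t: "t \<in> {0..T}" for j t
  proof -
    define M where "M = (MAX j\<in>UNIV. Im (x0 $ j))"
    have M_ge: "Im (x0 $ i) \<le> M" for i by (auto simp: M_def)
    have "cmod (v 1 (axis j 1) t - exp (\<i> * x t $ j))
        \<le> R ^ 1 * (Q ^ N / (exp 1 - 1)) * top_eigvec N 1 * exp (D0 * real N * t)"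
      using finite_section_error[OF assms(8) small Q, where v = v and k = 1
            and \<alpha> = "axis j 1" and t = t and N = N]
        assms(7,11,13) t axis_mem_mi_nonneg_deg[of j] by (simp add: mi_dot_axis)
    also have "\<dots> \<le> R ^ 1 * (Q ^ N / (exp 1 - 1)) * (exp 1 ^ N * real N powr (-3/2) / 2)
        * exp (D0 * real N * t)"
      using top_eigvec_1_bound[OF \<open>N \<ge> 1\<close>] Q \<open>R > 0\<close>
      by (intro mult_right_mono mult_left_mono) auto
    also have "\<dots> = R / (2 * (e - 1)) * real N powr (-3/2) * exp (D0 * t * real N) * (Q ^ N * exp 1 ^ N)"
      by (simp add: e_def mult_ac)
    also have "Q ^ N * exp 1 ^ N = P"
      unfolding power_mult_distrib[symmetric]
      by (simp add: Q_def P_def flip: exp_add exp_of_nat_mult)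
    finally have diff: "cmod (v 1 (axis j 1) t - exp (\<i> * x t $ j))
        \<le> R / (2 * (e - 1)) * real N powr (-3/2) * exp (D0 * t * real N) * P" .
    have inv: "R / cmod (exp (\<i> * x t $ j)) \<le> sqrt (2 * pi) * (e - 1) * C_CF R x0"
    proof -
      \<comment> \<open>The maximum \<open>M\<close> enters twice: through the initial size of the monomial, and through the time
        \<open>T\<close>, whose bound involves the minimum of the imaginary parts, at most \<open>M\<close>.\<close>
      have "Im (x t $ j) \<le> M + c * T"
        using abs_Im_le_cmod[of "x t $ j - x0 $ j"] displacement[OF t, of j] M_ge[of j] by simp
      also have "c * T \<le> e / (2 * e - 1) * L" by (fact cT)
      also have "e / (2 * e - 1) * L \<le> e / (2 * e - 1) * (ln R + M - 1)"
      proof (intro mult_left_mono)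
        have "exp (- M) \<le> r"
          using r_ge[of undefined] M_ge[of undefined]
          by (smt (verit) exp_le_cancel_iff norm_exp_eq_Re Re_i_times)
        then have "- M \<le> ln r" using r_pos by (simp add: ln_ge_iff)
        then show "L \<le> ln R + M - 1" by (simp add: L_def)
      qed (use e1 in auto)
      finally have "ln R + Im (x t $ j) \<le> ln R + (M + e / (2 * e - 1) * (ln R + M - 1))"
        by simp
      also have "\<dots> = (3 * e - 1) / (2 * e - 1) * M + (3 * e - 1) / (2 * e - 1) * ln R - e / (2 * e - 1)"
        using e1 by (simp add: divide_simps) (simp add: algebra_simps)
      finally have "exp (ln R + Im (x t $ j)) \<le> exp \<dots>" by simp
      moreover have "exp (ln R + Im (x t $ j)) = R / cmod (exp (\<i> * x t $ j))"
        using \<open>R > 0\<close> by (simp add: norm_exp_eq_Re exp_add exp_minus divide_inverse)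
      ultimately show ?thesis
        using e1 by (simp add: C_CF_def e_def M_def)
    qed
    have "cmod (z j t) = cmod (v 1 (axis j 1) t - exp (\<i> * x t $ j)) / cmod (exp (\<i> * x t $ j))"
      by (simp add: z_def diff_divide_distrib del: norm_exp_eq_Re flip: norm_divide)
    also have "\<dots> \<le> R / (2 * (e - 1)) * real N powr (-3/2) * exp (D0 * t * real N) * P
        / cmod (exp (\<i> * x t $ j))"
      by (intro divide_right_mono diff) simp
    also have "\<dots> = R / cmod (exp (\<i> * x t $ j))
        * (real N powr (-3/2) * exp (D0 * t * real N) * P / (2 * (e - 1)))"
      by (simp only: times_divide_eq_left times_divide_eq_right divide_divide_eq_left mult_ac)
    also have "\<dots> \<le> sqrt (2 * pi) * (e - 1) * C_CF R x0
        * (real N powr (-3/2) * exp (D0 * t * real N) * P / (2 * (e - 1)))"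
      using e1 by (intro mult_right_mono inv) (auto simp: P_def)
    also have "\<dots> = sqrt (2 * pi) / 2 * B t"
      using e1 by (simp add: B_def) (simp add: field_simps)
    also have "\<dots> \<le> 4 / 3 * B t"
    proof (intro mult_right_mono)
      have "sqrt (2 * pi) \<le> 8 / 3"
        using pi_approx by (intro real_le_lsqrt) (auto simp: power2_eq_square)
      then show "sqrt (2 * pi) / 2 \<le> 4 / 3" by simp
    qed (use C_pos in \<open>auto simp: B_def P_def\<close>)
    finally show ?thesis .
  qed
  have z_small: "cmod (z j t) \<le> 2 / 3" if "t \<in> {0..T}" for j t
    using z_bound[OF that, of j] B_half[OF that] by simp
  have v_eq: "v 1 (axis j 1) t = exp (\<i> * x t $ j) * (1 + z j t)" for j t
    by (simp add: z_def)
  have Re_pos: "Re (1 + z j t) > 0" if "t \<in> {0..T}" for j t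
    using z_small[OF that, of j] abs_Re_le_cmod[of "z j t"] by simp
  then have nz: "1 + z j t \<noteq> 0" if "t \<in> {0..T}" for j t
    using that by (metis less_irrefl zero_complex.simps(1))
  have nonzero: "\<forall>j. \<forall>t\<in>{0..T}. v 1 (axis j 1) t \<noteq> 0"
    unfolding v_eq using nz by simp
  \<comment> \<open>The principal logarithm is continuous along \<open>1 + z j t\<close>, which stays in the right half plane. The
    value at \<open>0\<close> is prescribed because the initial condition is claimed even for \<open>T < 0\<close>.\<close>
  define \<xi> where "\<xi> j t = (if t = 0 then x0 $ j else x t $ j - \<i> * Ln (1 + z j t))" for j t
  have \<xi>: "\<xi> j t = x t $ j - \<i> * Ln (1 + z j t)" if "t \<in> {0..T}" for j t
  proof (cases "t = 0")
    case True
    have "v 1 (axis j 1) 0 = exp (\<i> * x0 $ j)"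
      using assms(11,13) axis_mem_mi_nonneg_deg[of j]
      by (auto simp: finite_section_solution_def mi_dot_axis)
    then show ?thesis using True by (simp add: \<xi>_def z_def assms(7))
  qed (simp add: \<xi>_def)
  have "continuous_on {0..T} (\<xi> j)" for j
  proof -
    have "continuous_on {0..T} x"
      using assms(8) by (rule continuous_on_vector_derivative)
    moreover have "continuous_on {0..T} (v 1 (axis j 1))"
    proof -
      have "(v 1 (axis j 1) has_vector_derivative (\<Sum>l=1..N. \<Sum>\<beta>\<in>mi_nonneg_deg l.
          cf_entry gc t (axis j 1) \<beta> * v l \<beta> t)) (at t within {0..T})" if "t \<in> {0..T}" for t
      proof -
        have "1 \<in> {1..N}" using assms(11) by simp
        with assms(13) axis_mem_mi_nonneg_deg[of j] that show ?thesis
          unfolding finite_section_solution_def by blast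
      qed
      then show ?thesis
        by (rule continuous_on_vector_derivative)
    qed
    ultimately have "continuous_on {0..T} (\<lambda>t. x t $ j - \<i> * Ln (1 + z j t))"
      using Re_pos unfolding z_def
      by (intro continuous_intros) (auto simp: complex_nonpos_Reals_iff not_le)
    then show ?thesis using \<xi> by (subst continuous_on_cong[OF refl \<xi>]) auto
  qed
  moreover have "\<xi> j 0 = x0 $ j" for j by (simp add: \<xi>_def)
  moreover have "v 1 (axis j 1) t = exp (\<i> * \<xi> j t)" if "t \<in> {0..T}" for j t
    unfolding v_eq \<xi>[OF that] using nz[OF that]
    by (simp add: right_diff_distrib exp_add flip: mult.assoc)
  moreover have "(MAX j\<in>UNIV. cmod (\<xi> j t - x t $ j)) \<le>
         4 * C_CF R x0 * real N powr (-3/2) * exp (D0 * t * real N) *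
         (exp 1 * cmax_norm (exp_i x0) / R) powr ((exp 1 - 1) * real N / (2 * exp 1 - 1))"
    if t: "t \<in> {0..T}" for t
  proof -
    have "cmod (\<xi> j t - x t $ j) \<le> 4 * B t" for j
    proof -
      have "cmod (\<xi> j t - x t $ j) = cmod (Ln (1 + z j t))"
        by (simp add: \<xi>[OF t] norm_mult)
      also have "\<dots> \<le> cmod (z j t) / (1 - cmod (z j t))"
        using z_small[OF t, of j] by (intro norm_Ln_1_plus_le) simp
      also have "\<dots> \<le> cmod (z j t) / (1 / 3)"
        using z_small[OF t, of j] by (intro divide_left_mono mult_pos_pos) auto
      also have "\<dots> \<le> 4 * B t"
        using z_bound[OF t, of j] by simp
      finally show ?thesis .
    qed
    moreover have "P = (exp 1 * cmax_norm (exp_i x0) / R) powr ((exp 1 - 1) * real N / (2 * exp 1 - 1))"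
    proof -
      have "exp 1 * r / R = exp (- L)"
        unfolding r_eq using \<open>R > 0\<close> by (simp add: exp_diff exp_add exp_minus field_simps)
      then show ?thesis
        by (simp add: P_def \<kappa>_def e_def r_def powr_def)
    qed
    ultimately show ?thesis by (simp add: B_def mult.assoc)
  qed
  ultimately show ?thesis using nonzero by blast
qed

end
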